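(* Let $F:\mathbb{R}^n\rightrightarrows\mathbb{R}^q$ be a polyhedral convex set-valued map with recession mapping $G$, and let $C\subseteq\mathbb{R}^q$ be a pointed polyhedral convex cone with nonempty interior, such that the upper image $\mathcal{P}=\bigcup_{x\in\mathbb{R}^n}F(x)+C$ contains no line. Let (P) be the problem of minimizing $F(x)$ over $x\in\mathbb{R}^n$ with respect to $\preccurlyeq_C$, and let (VR) be its vectorial relaxation, i.e. the vector linear program of minimizing $f(x,y)=y$ with respect to $\leq_C$ subject to $y\in F(x)$. Let $(\bar{Z},\hat Z)$ with $$\bar{Z}=\left\{\begin{pmatrix} \bar{x}_1\\ \bar{y}_1\end{pmatrix},\ldots,\begin{pmatrix} \bar{x}_k \\ \bar{y}_k\end{pmatrix}\right\} \subseteq \mathbb{R}^n \times \mathbb{R}^q,\qquad \hat{Z}=\left\{\begin{pmatrix} \hat{x}_1\\ \hat{y}_1\end{pmatrix},\ldots,\begin{pmatrix} \hat{x}_l \\ \hat{y}_l\end{pmatrix}\right\} \subseteq (\mathbb{R}^n \times \mathbb{R}^q) \setminus \{0\}$$ be a finite infimizer for (VR). Then $(\bar X,\hat X)$ with $$\bar{X}=\{\bar{x}_1,\ldots,\bar{x}_k\} \quad \text{and} \quad \hat{X} = \{\hat{x}_1,\ldots,\hat{x}_l\}\setminus \{0\}$$ is a finite infimizer for problem (P).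
   Context: A convex polyhedron in $\mathbb{R}^q$ is a set of the form $P=\{y\in\mathbb{R}^q \mid By\ge b\}$ with $B\in\mathbb{R}^{m\times q}$, $b\in\mathbb{R}^m$; for such a nonempty $P$ the recession cone is $0^+P=\{y\in\mathbb{R}^q\mid By\ge 0\}$. For a set-valued map $F:\mathbb{R}^n\rightrightarrows\mathbb{R}^q$ (assigning to each $x\in\mathbb{R}^n$ a possibly empty subset of $\mathbb{R}^q$), $\operatorname{dom}F=\{x\in\mathbb{R}^n\mid F(x)\neq\emptyset\}$ and $\operatorname{gr}F=\{(x,y)\in\mathbb{R}^n\times\mathbb{R}^q\mid y\in F(x)\}$. $F$ is polyhedral convex if $\operatorname{gr}F$ is a convex polyhedron. The recession mapping $G:\mathbb{R}^n\rightrightarrows\mathbb{R}^q$ of $F$ is defined by $\operatorname{gr}G=0^+(\operatorname{gr}F)$. A polyhedral convex cone is pointed if it contains no line. $\operatorname{conv}$ denotes the convex hull and $\operatorname{cone} S$ the smallest convex cone containing $S$, where cones contain $0$ and $\operatorname{cone}\emptyset=\{0\}$. Sums of sets are Minkowski sums. The orderings are $V\preccurlyeq_C W :\Longleftrightarrow W\subseteq V+C$ for subsets of $\mathbb{R}^q$ and $v\le_C w:\Longleftrightarrow w-v\in C$ for vectors. Finite infimizer for (P): a tuple $(\bar X,\hat X)$ of finite sets $\bar X\subseteq\operatorname{dom}F$, $\bar X\ne\emptyset$, and $\hat X\subseteq\operatorname{dom}G\setminus\{0\}$ (possibly empty) such that $$\bigcup_{x \in \mathbb{R}^n} F(x) \subseteq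 \operatorname{conv} \bigcup_{x \in \bar{X}} F(x) + \operatorname{cone} \bigcup_{x \in \hat{X}} G(x) +C.$$ Finite infimizer for (VR): a finite infimizer in the same sense with $F$ replaced by the polyhedral convex map $\tilde F:\mathbb{R}^n\times\mathbb{R}^q\rightrightarrows\mathbb{R}^q$, $\operatorname{gr}\tilde F=\{(x,y,w)\mid w=y,\ (x,y)\in\operatorname{gr}F\}$, and $G$ replaced by the recession mapping $\tilde G$ of $\tilde F$, $\operatorname{gr}\tilde G=\{(x,y,w)\mid w=y,\ (x,y)\in\operatorname{gr}G\}$. Thus $\tilde F(x,y)=\{y\}$ if $(x,y)\in\operatorname{gr}F$ and $\tilde F(x,y)=\emptyset$ otherwise; $\tilde G(x,y)=\{y\}$ if $(x,y)\in\operatorname{gr}G$ and $\tilde G(x,y)=\emptyset$ otherwise. Explicitly, $(\bar Z,\hat Z)$ is a finite infimizer for (VR) if $\bar Z\subseteq\operatorname{dom}\tilde F$ is finite and nonempty, $\hat Z\subseteq\operatorname{dom}\tilde G\setminus\{0\}$ is finite (possibly empty), and $$\bigcup_{(x,y)\in\mathbb{R}^n\times\mathbb{R}^q}\tilde F(x,y)\subseteq \operatorname{conv}\bigcup_{(x,y)\in\bar Z}\tilde F(x,y)+\operatorname{cone}\bigcup_{(x,y)\in\hat Z}\tilde G(x,y)+C.$$ *)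

theory Defs
  imports "HOL-Analysis.Analysis"
begin

text \<open>
  A system \<open>B y \<ge> b\<close> of finitely many linear inequalities is encoded by the finite set \<open>H\<close> of
  its rows, each row being paired with its right-hand side; zero rows are allowed.
\<close>

definition ineq_solutions :: "('a::euclidean_space \<times> real) set \<Rightarrow> 'a set" where
  "ineq_solutions H = {y. \<forall>(a, \<beta>)\<in>H. a \<bullet> y \<ge> \<beta>}"

definition ineq_homogeneous :: "('a::euclidean_space \<times> real) set \<Rightarrow> 'a set" where
  "ineq_homogeneous H = {y. \<forall>(a, \<beta>)\<in>H. a \<bullet> y \<ge> 0}"

lemma polyhedron_iff_ineq_solutions:
  fixes P :: "'a::euclidean_space set"
  shows "polyhedron P \<longleftrightarrow> (\<exists>H. finite H \<and> P = ineq_solutions H)"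
proof
  assume "polyhedron P"
  then obtain \<F> where F: "finite \<F>" "P = \<Inter>\<F>"
    and "\<forall>h\<in>\<F>. \<exists>a b. a \<noteq> 0 \<and> h = {x. a \<bullet> x \<le> b}"
    unfolding polyhedron_def by blast
  then obtain a b where ab: "\<And>h. h \<in> \<F> \<Longrightarrow> h = {x. a h \<bullet> x \<le> b h}"
    by metis
  let ?H = "(\<lambda>h. (- a h, - b h)) ` \<F>"
  have "P = ineq_solutions ?H"
    unfolding F(2) ineq_solutions_def using ab by fastforce
  with F(1) show "\<exists>H. finite H \<and> P = ineq_solutions H" by blast
next
  assume "\<exists>H. finite H \<and> P = ineq_solutions H"
  then obtain H where H: "finite H" "P = ineq_solutions H" by blast
  have "P = \<Inter>((\<lambda>(a, \<beta>). {y. a \<bullet> y \<ge> \<beta>}) ` H)"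
    unfolding H(2) ineq_solutions_def by auto
  moreover have "polyhedron \<dots>"
    using H(1) by (intro polyhedron_Inter) (auto intro: polyhedron_halfspace_ge)
  ultimately show "polyhedron P" by simp
qed

text \<open>
  The recession cone of \<open>{y. B y \<ge> b}\<close> is \<open>{y. B y \<ge> 0}\<close>. It does not depend on the chosen
  system as long as the polyhedron is nonempty (\<open>recession_cone_ineq_solutions\<close> below); it is
  unspecified for the empty set and for sets that are not polyhedra.
\<close>

definition recession_cone :: "'a::euclidean_space set \<Rightarrow> 'a set" where
  "recession_cone P = ineq_homogeneous (SOME H. finite H \<and> P = ineq_solutions H)"

lemma ineq_homogeneous_eq:
  fixes H :: "('a::euclidean_space \<times> real) set"
  assumes "ineq_solutions H \<noteq> {}"
  shows "ineq_homogeneous H =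
    {d. \<forall>y\<in>ineq_solutions H. \<forall>t\<ge>0. y + t *\<^sub>R d \<in> ineq_solutions H}" (is "_ = ?R")
proof
  show "ineq_homogeneous H \<subseteq> ?R"
  proof (clarsimp simp: ineq_homogeneous_def ineq_solutions_def inner_right_distrib)
    fix d y :: 'a and t :: real and a \<beta>
    assume "\<forall>x\<in>H. case x of (a, \<beta>) \<Rightarrow> 0 \<le> a \<bullet> d" "\<forall>x\<in>H. case x of (a, \<beta>) \<Rightarrow> \<beta> \<le> a \<bullet> y"
      "0 \<le> t" "(a, \<beta>) \<in> H"
    then have "0 \<le> t * (a \<bullet> d)" "\<beta> \<le> a \<bullet> y" by fastforce+
    then show "\<beta> \<le> a \<bullet> y + t * (a \<bullet> d)" by linarith
  qed
  show "?R \<subseteq> ineq_homogeneous H"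
  proof
    fix d assume d: "d \<in> ?R"
    from assms obtain y where y: "y \<in> ineq_solutions H" by blast
    have "a \<bullet> d \<ge> 0" if aH: "(a, \<beta>) \<in> H" for a \<beta>
    proof (rule ccontr)
      assume neg: "\<not> a \<bullet> d \<ge> 0"
      define t where "t = (a \<bullet> y - \<beta> + 1) / - (a \<bullet> d)"
      have "a \<bullet> y \<ge> \<beta>" using y aH by (auto simp: ineq_solutions_def)
      with neg have "t \<ge> 0" by (simp add: t_def divide_nonneg_neg)
      with d y have "y + t *\<^sub>R d \<in> ineq_solutions H" by blast
      with aH have "a \<bullet> y + t * (a \<bullet> d) \<ge> \<beta>"
        by (auto simp: ineq_solutions_def inner_right_distrib)
      moreover have "t * (a \<bullet> d) = - (a \<bullet> y - \<beta> + 1)"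
        using neg by (simp add: t_def field_simps)
      ultimately show False by linarith
    qed
    then show "d \<in> ineq_homogeneous H" by (auto simp: ineq_homogeneous_def)
  qed
qed

lemma recession_cone_ineq_solutions:
  assumes "finite H" and "ineq_solutions H \<noteq> {}"
  shows "recession_cone (ineq_solutions H) = ineq_homogeneous H"
proof -
  let ?Q = "\<lambda>K. finite K \<and> ineq_solutions H = ineq_solutions K"
  define K where "K = (SOME K. ?Q K)"
  have "?Q K" unfolding K_def by (rule someI[of ?Q H]) (simp add: assms)
  then have "ineq_homogeneous K = ineq_homogeneous H"
    using assms(2) by (simp add: ineq_homogeneous_eq)
  then show ?thesis by (simp add: recession_cone_def K_def)
qed

lemma recession_cone_eq:
  assumes "polyhedron P" and "P \<noteq> {}"
  shows "recession_cone P = {d. \<forall>y\<in>P. \<forall>t\<ge>0. y + t *\<^sub>R d \<in> P}"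
proof -
  obtain H where "finite H" "P = ineq_solutions H"
    using assms(1) polyhedron_iff_ineq_solutions by blast
  with assms(2) show ?thesis
    by (simp add: recession_cone_ineq_solutions ineq_homogeneous_eq)
qed


definition dom :: "('a \<Rightarrow> 'b set) \<Rightarrow> 'a set" where
  "dom F = {x. F x \<noteq> {}}"

definition gr :: "('a \<Rightarrow> 'b set) \<Rightarrow> ('a \<times> 'b) set" where
  "gr F = {(x, y). y \<in> F x}"

definition polyhedral_convex_map ::
    "('a::euclidean_space \<Rightarrow> 'b::euclidean_space set) \<Rightarrow> bool" where
  "polyhedral_convex_map F \<longleftrightarrow> polyhedron (gr F)"

definition recession_map ::
    "('a::euclidean_space \<Rightarrow> 'b::euclidean_space set) \<Rightarrow> 'a \<Rightarrow> 'b set" where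
  "recession_map F = (\<lambda>x. {y. (x, y) \<in> recession_cone (gr F)})"

lemma gr_recession_map: "gr (recession_map F) = recession_cone (gr F)"
  by (auto simp: gr_def recession_map_def)

definition contains_line :: "'a::real_vector set \<Rightarrow> bool" where
  "contains_line S \<longleftrightarrow> (\<exists>x d. d \<noteq> 0 \<and> (\<forall>t. x + t *\<^sub>R d \<in> S))"

definition pointed :: "'a::real_vector set \<Rightarrow> bool" where
  "pointed C \<longleftrightarrow> \<not> contains_line C"

definition upper_image :: "('a \<Rightarrow> 'b::plus set) \<Rightarrow> 'b set \<Rightarrow> 'b set" where
  "upper_image F C = (\<Union>x. F x) + C"

text \<open>
  \<open>convex_cone hull S\<close> is the smallest convex cone containing \<open>S\<close>. Unlike for
  \<open>cone hull\<close>, its cones are nonempty, so the hull of the empty set is \<open>{0}\<close>.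
\<close>

definition finite_infimizer ::
    "('a::euclidean_space \<Rightarrow> 'b::euclidean_space set) \<Rightarrow> 'b set \<Rightarrow> 'a set \<Rightarrow> 'a set \<Rightarrow> bool" where
  "finite_infimizer F C Xbar Xhat \<longleftrightarrow>
     finite Xbar \<and> Xbar \<noteq> {} \<and> Xbar \<subseteq> dom F \<and>
     finite Xhat \<and> Xhat \<subseteq> dom (recession_map F) - {0} \<and>
     (\<Union>x. F x) \<subseteq>
       convex hull (\<Union>x\<in>Xbar. F x) + convex_cone hull (\<Union>x\<in>Xhat. recession_map F x) + C"

text \<open>
  The vectorial relaxation of minimizing \<open>F\<close> minimizes \<open>f (x, y) = y\<close> over \<open>(x, y) \<in> gr F\<close>. It is
  represented by the set-valued map sending a feasible \<open>(x, y)\<close> to \<open>{y}\<close> and any other point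
  to \<open>{}\<close>.
\<close>

definition vectorial_relaxation :: "('a \<Rightarrow> 'b set) \<Rightarrow> 'a \<times> 'b \<Rightarrow> 'b set" where
  "vectorial_relaxation F = (\<lambda>(x, y). {w. w = y \<and> (x, y) \<in> gr F})"

lemma polyhedral_convex_map_vectorial_relaxation:
  fixes F :: "'a::euclidean_space \<Rightarrow> 'b::euclidean_space set"
  assumes "polyhedral_convex_map F"
  shows "polyhedral_convex_map (vectorial_relaxation F)"
proof -
  obtain H where H: "finite H" "gr F = ineq_solutions H"
    using assms by (auto simp: polyhedral_convex_map_def polyhedron_iff_ineq_solutions)
  let ?K = "(\<lambda>(a, \<beta>). ((a, 0::'b), \<beta>)) ` H"
  let ?D = "{((x::'a, y::'b), w::'b). w = y}"
  have "subspace ?D" by (auto simp: subspace_def zero_prod_def)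
  then have "polyhedron ?D" by (simp add: affine_imp_polyhedron subspace_imp_affine)
  moreover have "polyhedron (ineq_solutions ?K)"
    using H(1) polyhedron_iff_ineq_solutions by blast
  moreover have "gr (vectorial_relaxation F) = ineq_solutions ?K \<inter> ?D"
    unfolding gr_def vectorial_relaxation_def H(2)[unfolded gr_def]
    by (auto simp: ineq_solutions_def split_beta)
  ultimately show ?thesis by (simp add: polyhedral_convex_map_def)
qed

lemma gr_recession_map_vectorial_relaxation:
  fixes F :: "'a::euclidean_space \<Rightarrow> 'b::euclidean_space set"
  assumes "polyhedral_convex_map F" and "gr F \<noteq> {}"
  shows "gr (recession_map (vectorial_relaxation F)) =
    {((x, y), w). w = y \<and> (x, y) \<in> gr (recession_map F)}"
proof -
  let ?T = "gr (vectorial_relaxation F)"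
  have T: "?T = {((x, y), w). w = y \<and> (x, y) \<in> gr F}"
    by (auto simp: gr_def vectorial_relaxation_def)
  have "?T \<noteq> {}" using assms(2) unfolding T by auto
  then have RT: "d \<in> recession_cone ?T \<longleftrightarrow> (\<forall>z\<in>?T. \<forall>t\<ge>0. z + t *\<^sub>R d \<in> ?T)" for d
    using polyhedral_convex_map_vectorial_relaxation[OF assms(1)]
    by (subst recession_cone_eq) (auto simp: polyhedral_convex_map_def)
  have RF: "d \<in> recession_cone (gr F) \<longleftrightarrow> (\<forall>z\<in>gr F. \<forall>t\<ge>0. z + t *\<^sub>R d \<in> gr F)" for d
    using assms by (subst recession_cone_eq) (auto simp: polyhedral_convex_map_def)
  have eq: "w = y" if "((x, y), w) \<in> recession_cone ?T" for x y w
  proof -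
    obtain a b where "(a, b) \<in> gr F" using assms(2) by auto
    then have "((a, b), b) \<in> ?T" by (simp add: T)
    with that have "((a, b), b) + 1 *\<^sub>R ((x, y), w) \<in> ?T" using RT zero_le_one by blast
    then show ?thesis by (simp add: T)
  qed
  have iff: "((x, y), y) \<in> recession_cone ?T \<longleftrightarrow> (x, y) \<in> recession_cone (gr F)" for x y
    unfolding RT RF unfolding T by auto
  show ?thesis
    unfolding gr_recession_map using eq iff by blast
qed

end

theory Submission
  imports Defs
begin

text \<open>
  A direction \<open>(0, y)\<close> in \<open>Zhat\<close> is dropped when passing to \<open>fst ` Zhat - {0}\<close>. Nothing is lost:
  such a \<open>y\<close> belongs to the convex cone \<open>G 0\<close> of directions that translate every value \<open>F x\<close> into
  itself, hence it also translates \<open>convex hull (\<Union>x\<in>Xbar. F x)\<close> into itself.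
\<close>

text \<open>Nothing is assumed about \<open>F\<close>: whichever system \<open>SOME\<close> picks,
  \<open>recession_cone\<close> solves homogeneous inequalities, and so does its slice at first
  component 0.\<close>

lemma convex_cone_recession_map_0:
  "convex_cone (recession_map F 0)"
  unfolding convex_cone_iff recession_map_def recession_cone_def ineq_homogeneous_def
  by (auto simp: inner_right_distrib inner_prod_def split_beta)

lemma recession_map_0_absorb:
  assumes "polyhedral_convex_map F" "d \<in> recession_map F 0" "y \<in> F x"
  shows "y + d \<in> F x"
proof -
  have "polyhedron (gr F)" "(x, y) \<in> gr F"
    using assms by (auto simp: polyhedral_convex_map_def gr_def)
  moreover have "(0, d) \<in> recession_cone (gr F)"
    using assms(2) by (simp add: recession_map_def)
  \<comment> \<open>Step length \<open>t = 1\<close>; the direction has first component 0, so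
    \<open>x\<close> stays fixed. Dropping \<open>scaleR_one\<close> keeps the factor 1 visible for
    matching \<open>t\<close>.\<close>
  ultimately have "(x, y) + 1 *\<^sub>R (0, d) \<in> gr F"
    by (subst (asm) recession_cone_eq) (auto simp del: scaleR_one)
  then show ?thesis by (simp add: gr_def)
qed

text \<open>Translation by a single \<open>d\<close> commutes with taking the convex hull and maps
  the union of the values into itself.\<close>

lemma convex_hull_plus_recession_map_0_subset:
  assumes "polyhedral_convex_map F"
  shows "convex hull (\<Union>x\<in>X. F x) + recession_map F 0 \<subseteq> convex hull (\<Union>x\<in>X. F x)"
proof
  fix z assume "z \<in> convex hull (\<Union>x\<in>X. F x) + recession_map F 0"
  then obtain s d where z: "z = s + d" and s: "s \<in> convex hull (\<Union>x\<in>X. F x)"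
    and d: "d \<in> recession_map F 0"
    by (auto elim: set_plus_elim)
  have "d + s \<in> convex hull ((+) d ` (\<Union>x\<in>X. F x))"
    unfolding convex_hull_translation using s by blast
  also have "\<dots> \<subseteq> convex hull (\<Union>x\<in>X. F x)"
    using recession_map_0_absorb[OF assms d] by (intro hull_mono) (auto simp: add.commute)
  finally show "z \<in> convex hull (\<Union>x\<in>X. F x)"
    by (simp add: z add.commute)
qed

text \<open>A sum of convex cones is a convex cone, and it contains both summands because each
  contains 0; minimality of the hull does the rest.\<close>

lemma convex_cone_hull_subset_plus:
  assumes "convex_cone D" "A \<subseteq> B \<union> D"
  shows "convex_cone hull A \<subseteq> convex_cone hull B + D"
proof (rule hull_minimal)
  have "0 \<in> D" "0 \<in> convex_cone hull B"
    using assms(1) convex_cone_convex_cone_hull convex_cone_contains_0 by blast+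
  then show "A \<subseteq> convex_cone hull B + D"
    using assms(2) hull_subset[of B convex_cone]
    by (force simp: set_plus_def intro: bexI[of _ 0])
  have "convex_cone hull B + D = (\<Union>x\<in>convex_cone hull B. \<Union>y\<in>D. {x + y})"
    by (auto simp: set_plus_def)
  then show "convex_cone (convex_cone hull B + D)"
    using convex_cone_sums[OF convex_cone_convex_cone_hull assms(1), of B] by simp
qed

theorem theorem11:
  fixes F :: "(real ^ 'n) \<Rightarrow> (real ^ 'q) set"
    and C :: "(real ^ 'q) set"
    and Zbar Zhat :: "((real ^ 'n) \<times> (real ^ 'q)) set"
  assumes "polyhedral_convex_map F"
    and "polyhedron C" and "convex_cone C" and "pointed C" and "interior C \<noteq> {}"
    and "\<not> contains_line (upper_image F C)"
    and "finite_infimizer (vectorial_relaxation F) C Zbar Zhat"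
  shows "finite_infimizer F C (fst ` Zbar) (fst ` Zhat - {0})"
proof -
  let ?V = "vectorial_relaxation F" and ?G = "recession_map F"
  let ?S = "convex hull (\<Union>x\<in>fst ` Zbar. F x)"
  let ?K = "convex_cone hull (\<Union>x\<in>fst ` Zhat - {0}. ?G x)"
  note inf = assms(7)[unfolded finite_infimizer_def]
  have Zbar: "snd z \<in> F (fst z)" if "z \<in> Zbar" for z
    using inf that by (force simp: dom_def vectorial_relaxation_def gr_def split: prod.splits)
  moreover obtain z where "z \<in> Zbar" using inf by blast
  ultimately have "(fst z, snd z) \<in> gr F" by (simp add: gr_def split_beta)
  \<comment> \<open>Nonemptiness matters: \<open>recession_cone\<close> is unspecified on the empty
    set.\<close>
  then have "gr F \<noteq> {}" by blast
  then have gr_G: "gr (recession_map ?V) = {((x, y), w). w = y \<and> (x, y) \<in> gr ?G}"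
    by (rule gr_recession_map_vectorial_relaxation[OF assms(1)])
  have G: "recession_map ?V z = {w. w = snd z \<and> w \<in> ?G (fst z)}" for z
  proof -
    have "w \<in> recession_map ?V z \<longleftrightarrow> (z, w) \<in> gr (recession_map ?V)" for w
      by (simp add: gr_def)
    then show ?thesis
      unfolding gr_G by (auto simp: gr_def split_beta)
  qed
  have Zhat: "snd z \<in> ?G (fst z)" if "z \<in> Zhat" for z
    using inf that by (force simp: dom_def G)
  have "(\<Union>x. F x) \<subseteq> (\<Union>z. ?V z)"
    by (force simp: vectorial_relaxation_def gr_def)
  also have "\<dots> \<subseteq> convex hull (\<Union>z\<in>Zbar. ?V z) + convex_cone hull (\<Union>z\<in>Zhat. recession_map ?V z) + C"
    using inf by blast
  also have "\<dots> \<subseteq> ?S + (?K + ?G 0) + C"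
  proof (intro set_plus_mono2 order_refl)
    show "convex hull (\<Union>z\<in>Zbar. ?V z) \<subseteq> ?S"
      by (intro hull_mono) (auto simp: vectorial_relaxation_def gr_def)
    \<comment> \<open>Generators from points with first component 0 fall into \<open>?G 0\<close>,
      all others into the union spanning \<open>?K\<close>.\<close>
    show "convex_cone hull (\<Union>z\<in>Zhat. recession_map ?V z) \<subseteq> ?K + ?G 0"
      by (intro convex_cone_hull_subset_plus convex_cone_recession_map_0) (auto simp: G)
  qed
  \<comment> \<open>\<open>?G 0\<close> is moved next to \<open>?S\<close>, the summand that absorbs
    it.\<close>
  also have "\<dots> = (?S + ?G 0) + ?K + C"
    by (simp add: ac_simps)
  also have "\<dots> \<subseteq> ?S + ?K + C"
    by (intro set_plus_mono2 order_refl convex_hull_plus_recession_map_0_subset assms(1))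
  finally have "(\<Union>x. F x) \<subseteq> ?S + ?K + C" .
  moreover have "fst ` Zbar \<subseteq> dom F" "fst ` Zhat - {0} \<subseteq> dom ?G - {0}"
    using Zbar Zhat unfolding dom_def by blast+
  ultimately show ?thesis
    using inf unfolding finite_infimizer_def by blast
qed

end
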